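(* Let $G$ be a graph isomorphic to one of $C_5$, the bull, the gem, the co-gem, and let $r\in(\mathbb{N}\setminus\{1\})\cup\{\infty\}$. Then the radius-$r$ flip-width of $G$ is at least $3$.
   Context: $\mathbb{N}$ is the set of positive integers. All graphs are finite, simple. For $A,B\subseteq V(G)$, $G\oplus(A,B)$ is the graph on $V(G)$ in which the adjacency of distinct $u,v$ is toggled exactly when $(u,v)\in(A\times B)\cup(B\times A)$; $G\oplus\mathcal{S}$ applies all flips in a collection $\mathcal{S}$. For a partition $\mathcal{P}$ of $V(G)$, a $\mathcal{P}$-flip is $G\oplus\mathcal{S}$ with all pairs in $\mathcal{S}$ of the form $(X,Y)$, $X,Y\in\mathcal{P}$; a $k$-flip is a $\mathcal{P}$-flip with $|\mathcal{P}|\le k$. Flipper game of radius $r\in\mathbb{N}\cup\{\infty\}$ and width $k$: $G_0=G$, the runner picks $v_0$; in round $i\ge1$ the flipper announces a $k$-flip $G_i$ of $G$, then the runner (knowing $G_i$) moves to $v_i$ reachable from $v_{i-1}$ by a path of length at most $r$ in $G_{i-1}$ (any vertex of the same component if $r=\infty$). The flipper wins when the runner's position $v_i$ is isolated in $G_i$. The radius-$r$ flip-width is the minimum $k$ such that the flipper has a winning strategy. $C_5$ is the 5-cycle; with $abcd$ an induced path and a fifth vertex $v$: the bull has $v$ adjacent exactly to $b,c$; the gem has $v$ adjacent to all of $a,b,c,d$; the co-gem has $v$ isolated. *)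

theory Defs
  imports
    "Graph_Theory.Graph_Theory"
    "HOL-Library.Disjoint_Sets"
    "HOL-Library.Extended_Nat"
begin

text \<open>
  A finite simple graph is a \<^locale>\<open>pair_graph\<close>, that is, a finite loopfree symmetric
  digraph whose arcs are pairs of vertices: an edge between \<open>u\<close> and \<open>v\<close> is the pair of arcs
  \<open>(u, v)\<close> and \<open>(v, u)\<close>.
\<close>

definition graph_of :: "'a set \<Rightarrow> ('a \<times> 'a) set \<Rightarrow> 'a pair_pre_digraph" where
  "graph_of V E = \<lparr>pverts = V, parcs = E \<union> E\<inverse>\<rparr>"

text \<open>In the last three graphs, the induced path \<open>a b c d\<close> is \<open>0 1 2 3\<close> and the fifth vertex is \<open>4\<close>.\<close>

definition C5_graph :: "nat pair_pre_digraph" where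
  "C5_graph = graph_of {0, 1, 2, 3, 4} {(0, 1), (1, 2), (2, 3), (3, 4), (4, 0)}"

definition bull_graph :: "nat pair_pre_digraph" where
  "bull_graph = graph_of {0, 1, 2, 3, 4} {(0, 1), (1, 2), (2, 3), (4, 1), (4, 2)}"

definition gem_graph :: "nat pair_pre_digraph" where
  "gem_graph = graph_of {0, 1, 2, 3, 4}
     {(0, 1), (1, 2), (2, 3), (4, 0), (4, 1), (4, 2), (4, 3)}"

definition co_gem_graph :: "nat pair_pre_digraph" where
  "co_gem_graph = graph_of {0, 1, 2, 3, 4} {(0, 1), (1, 2), (2, 3)}"

definition flip :: "'a set \<Rightarrow> 'a set \<Rightarrow> 'a pair_pre_digraph \<Rightarrow> 'a pair_pre_digraph" where
  "flip A B G = G\<lparr>parcs := {(u, v). u \<noteq> v \<and>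
     ((u, v) \<in> parcs G) \<noteq> ((u, v) \<in> A \<times> B \<union> B \<times> A)}\<rparr>"

text \<open>
  All flips of a finite collection \<open>S\<close>, applied one after the other; by the lemma below the
  order is irrelevant. If \<open>A \<noteq> B\<close> and both \<open>(A, B)\<close> and \<open>(B, A)\<close> are in \<open>S\<close>, they cancel.
\<close>

definition flips :: "('a set \<times> 'a set) set \<Rightarrow> 'a pair_pre_digraph \<Rightarrow> 'a pair_pre_digraph" where
  "flips S G = Finite_Set.fold (\<lambda>(A, B). flip A B) G S"

lemma comp_fun_commute_flip:
  "comp_fun_commute
     (\<lambda>(A, B). flip A B :: 'a pair_pre_digraph \<Rightarrow> 'a pair_pre_digraph)"
proof
  have "flip A B (flip C D G) = flip C D (flip A B G)" for A B C D and G :: "'a pair_pre_digraph"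
    by (rule pair_pre_digraph.equality) (auto simp: flip_def)
  then show "(\<lambda>(A, B). flip A B) y \<circ> (\<lambda>(A, B). flip A B) x =
        (\<lambda>(A, B). flip A B) x \<circ> (\<lambda>(A, B). flip A B) y"
    for x y :: "'a set \<times> 'a set"
    by (cases x; cases y) (simp add: fun_eq_iff)
qed

definition partition_flip ::
  "'a set set \<Rightarrow> 'a pair_pre_digraph \<Rightarrow> 'a pair_pre_digraph \<Rightarrow> bool" where
  "partition_flip P G H \<longleftrightarrow> (\<exists>S \<subseteq> P \<times> P. H = flips S G)"

definition k_flip :: "nat \<Rightarrow> 'a pair_pre_digraph \<Rightarrow> 'a pair_pre_digraph \<Rightarrow> bool" where
  "k_flip k G H \<longleftrightarrow>
     (\<exists>P. partition_on (pverts G) P \<and> finite P \<and> card P \<le> k \<and> partition_flip P G H)"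

text \<open>
  In \<open>apath\<close>, the path \<open>p\<close> is the list of its arcs, so its length is the number of edges. For
  \<open>r = \<infinity>\<close> the length is unconstrained, so \<open>v\<close> is any vertex of the component of \<open>u\<close>.
\<close>

definition reachable_within ::
  "enat \<Rightarrow> 'a pair_pre_digraph \<Rightarrow> 'a \<Rightarrow> 'a \<Rightarrow> bool" where
  "reachable_within r G u v \<longleftrightarrow>
     (\<exists>p. pre_digraph.apath (with_proj G) u p v \<and> enat (length p) \<le> r)"

definition isolated_vertex :: "'a pair_pre_digraph \<Rightarrow> 'a \<Rightarrow> bool" where
  "isolated_vertex G v \<longleftrightarrow> v \<in> pverts G \<and> (\<forall>u. (v, u) \<notin> parcs G)"

text \<open>
  A strategy of the flipper computes the graph \<open>G\<^sub>i\<close> announced in round \<open>i \<ge> 1\<close> from the list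
  \<open>[v\<^sub>0, \<dots>, v\<^sub>i\<^sub>-\<^sub>1]\<close> of the positions of the runner so far.
\<close>

type_synonym 'a strategy = "'a list \<Rightarrow> 'a pair_pre_digraph"

definition game_graph ::
  "'a pair_pre_digraph \<Rightarrow> 'a strategy \<Rightarrow> (nat \<Rightarrow> 'a) \<Rightarrow> nat \<Rightarrow> 'a pair_pre_digraph" where
  "game_graph G \<sigma> v i = (if i = 0 then G else \<sigma> (map v [0..<i]))"

text \<open>
  The runner may always stay in place, so letting plays continue forever, also after the
  flipper has won, changes nothing.
\<close>

definition runner_play ::
  "enat \<Rightarrow> 'a pair_pre_digraph \<Rightarrow> 'a strategy \<Rightarrow> (nat \<Rightarrow> 'a) \<Rightarrow> bool" where
  "runner_play r G \<sigma> v \<longleftrightarrow> v 0 \<in> pverts G \<and>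
     (\<forall>i \<ge> 1. reachable_within r (game_graph G \<sigma> v (i - 1)) (v (i - 1)) (v i))"

definition flipper_winning_strategy ::
  "enat \<Rightarrow> nat \<Rightarrow> 'a pair_pre_digraph \<Rightarrow> 'a strategy \<Rightarrow> bool" where
  "flipper_winning_strategy r k G \<sigma> \<longleftrightarrow> (\<forall>vs. k_flip k G (\<sigma> vs)) \<and>
     (\<forall>v. runner_play r G \<sigma> v \<longrightarrow> (\<exists>i. isolated_vertex (game_graph G \<sigma> v i) (v i)))"

text \<open>
  The minimum exists for finite graphs: splitting the vertex set into singletons, the flipper
  can announce the edgeless graph in the first round.
\<close>

definition flip_width :: "enat \<Rightarrow> 'a pair_pre_digraph \<Rightarrow> nat" where
  "flip_width r G = (LEAST k. k \<ge> 1 \<and> (\<exists>\<sigma>. flipper_winning_strategy r k G \<sigma>))"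

end

theory Submission
  imports Defs
begin

text \<open>
  Call a pair of vertices \<open>u, v\<close> \<^emph>\<open>mixed\<close> if some third vertex is adjacent to exactly one of them
  and some third vertex is adjacent to both or to neither. In each of the four graphs all pairs
  are mixed, and this alone lets the runner survive against 2-flips: for all 2-flips \<open>H\<close>, \<open>H'\<close>
  and every non-isolated \<open>v\<close> of \<open>H\<close>, some vertex at distance at most 2 from \<open>v\<close> in \<open>H\<close> is not
  isolated in \<open>H'\<close>.

  Indeed, two non-adjacent vertices of \<open>H\<close> in the same part with no further neighbours are
  adjacent in \<open>G\<close> to the same third vertices, so they do not form a mixed pair. Hence at most two
  vertices are isolated in \<open>H'\<close>, one in each part. If the ball around \<open>v\<close> consists of isolated
  vertices of \<open>H'\<close>, it is therefore \<open>{v, u}\<close> with \<open>u\<close> the only neighbour of \<open>v\<close>, and \<open>u\<close> and \<open>v\<close>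
  lie in different parts for \<open>H\<close> and for \<open>H'\<close>. The pair \<open>u, v\<close> is flipped by exactly one of the
  two flips, and comparing with this pair shows that every third vertex is adjacent to exactly one of
  \<open>u\<close> and \<open>v\<close>.
\<close>

definition all_pairs_mixed :: "'a pair_pre_digraph \<Rightarrow> bool" where
  "all_pairs_mixed G \<longleftrightarrow> (\<forall>u \<in> pverts G. \<forall>v \<in> pverts G. u \<noteq> v \<longrightarrow>
     (\<exists>w \<in> pverts G - {u, v}. ((u, w) \<in> parcs G) \<noteq> ((v, w) \<in> parcs G)) \<and>
     (\<exists>w \<in> pverts G - {u, v}. ((u, w) \<in> parcs G) = ((v, w) \<in> parcs G)))"

section \<open>Elementary facts about finite simple graphs\<close>

lemma pair_graph_sym: "pair_graph G \<Longrightarrow> (u, v) \<in> parcs G \<longleftrightarrow> (v, u) \<in> parcs G"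
  using pair_sym_digraph.pair_sym_arcs[of G]
  by (auto simp: pair_graph_def pair_pseudo_graph_def symmetric_def dest: symD)

lemma pair_graph_no_loop: "pair_graph G \<Longrightarrow> (v, v) \<notin> parcs G"
  using pair_loopfree_digraph.pair_no_loops[of G "(v, v)"]
  by (auto simp: pair_graph_def pair_digraph_def)

lemma pair_graph_arc_in_verts:
  "pair_graph G \<Longrightarrow> (u, v) \<in> parcs G \<Longrightarrow> u \<in> pverts G \<and> v \<in> pverts G"
  using pair_wf_digraph.arc_fst_in_verts[of G "(u, v)"] pair_wf_digraph.arc_snd_in_verts[of G "(u, v)"]
  by (auto simp: pair_graph_def pair_digraph_def pair_fin_digraph_def)

lemma pair_graph_finite_verts: "pair_graph G \<Longrightarrow> finite (pverts G)"
  by (simp add: pair_graph_def pair_digraph_def pair_fin_digraph.pair_finite_verts)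

section \<open>Flips in closed form\<close>

text \<open>Each flip toggles the pairs that it covers, so only a parity matters. Loops are excluded
  because the right-hand side drops the diagonal even for empty \<open>S\<close>.\<close>

lemma flips_eq:
  assumes "finite S" "\<And>v. (v, v) \<notin> parcs G"
  shows "flips S G = G\<lparr>parcs := {(u, v). u \<noteq> v \<and> ((u, v) \<in> parcs G) \<noteq>
           odd (card {s \<in> S. (u, v) \<in> fst s \<times> snd s \<union> snd s \<times> fst s})}\<rparr>"
  using assms(1)
proof (induction S)
  case empty
  have "{(u, v). u \<noteq> v \<and> (u, v) \<in> parcs G} = parcs G"
    using assms(2) by auto
  then show ?case
    by (simp add: flips_def)
next
  case (insert s S)
  interpret comp_fun_commute
    "(\<lambda>(A, B). flip A B :: 'a pair_pre_digraph \<Rightarrow> 'a pair_pre_digraph)"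
    by (rule comp_fun_commute_flip)
  have count: "card {t \<in> insert s S. P t} = (if P s then Suc else id) (card {t \<in> S. P t})" for P
  proof -
    have "{t \<in> insert s S. P t} = (if P s then insert s {t \<in> S. P t} else {t \<in> S. P t})"
      by auto
    then show ?thesis
      using insert.hyps by simp
  qed
  have "flips (insert s S) G = flip (fst s) (snd s) (flips S G)"
    using insert.hyps by (simp add: flips_def fold_insert split_beta)
  then show ?case
    unfolding insert.IH count by (intro pair_pre_digraph.equality) (auto simp: flip_def split: if_splits)
qed

text \<open>Parts are disjoint, so only \<open>(A, B)\<close> and \<open>(B, A)\<close> can toggle a
  pair between \<open>A\<close> and \<open>B\<close>; the resulting parity depends on the parts
  alone and is recorded by \<open>c\<close>.\<close>

lemma k_flip_cases:
  assumes "k_flip k G H" "pair_graph G"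
  obtains P c where
    "partition_on (pverts G) P" "finite P" "card P \<le> k" "pverts H = pverts G"
    "\<And>A B. c A B = c B A"
    "\<And>A B u v. A \<in> P \<Longrightarrow> B \<in> P \<Longrightarrow> u \<in> A \<Longrightarrow> v \<in> B \<Longrightarrow>
       (u, v) \<in> parcs H \<longleftrightarrow> u \<noteq> v \<and> ((u, v) \<in> parcs G) \<noteq> c A B"
    "\<And>u v. (u, v) \<in> parcs H \<Longrightarrow> u \<in> pverts G \<and> v \<in> pverts G"
proof -
  obtain P S where P: "partition_on (pverts G) P" "finite P" "card P \<le> k"
    and S: "S \<subseteq> P \<times> P" and H: "H = flips S G"
    using assms(1) by (auto simp: k_flip_def partition_flip_def)
  have "finite S"
    using S P(2) finite_subset by blast
  define n where "n u v = card {s \<in> S. (u, v) \<in> fst s \<times> snd s \<union> snd s \<times> fst s}" for u v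
  define c where "c A B = odd (card {s \<in> S. s = (A, B) \<or> s = (B, A)})" for A B
  have H_eq: "H = G\<lparr>parcs := {(u, v). u \<noteq> v \<and> ((u, v) \<in> parcs G) \<noteq> odd (n u v)}\<rparr>"
    unfolding H n_def using \<open>finite S\<close> pair_graph_no_loop[OF assms(2)] by (rule flips_eq)
  have part: "A = B" if "A \<in> P" "B \<in> P" "x \<in> A" "x \<in> B" for A B x
    using P(1) that by (auto simp: partition_on_def disjoint_def)
  have n_eq: "odd (n u v) = c A B" if "A \<in> P" "B \<in> P" "u \<in> A" "v \<in> B" for A B u v
  proof -
    have "{s \<in> S. (u, v) \<in> fst s \<times> snd s \<union> snd s \<times> fst s} = {s \<in> S. s = (A, B) \<or> s = (B, A)}"
      using that S part by (auto; blast)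
    then show ?thesis
      by (simp add: n_def c_def)
  qed
  have inV: "u \<in> pverts G \<and> v \<in> pverts G" if "(u, v) \<in> parcs H" for u v
  proof (rule ccontr)
    assume out: "\<not> (u \<in> pverts G \<and> v \<in> pverts G)"
    have "{s \<in> S. (u, v) \<in> fst s \<times> snd s \<union> snd s \<times> fst s} = {}"
      using out S P(1) by (fastforce simp: partition_on_def)
    then have "n u v = 0"
      by (simp only: n_def card.empty)
    then have "(u, v) \<in> parcs G"
      using that by (simp add: H_eq)
    then show False
      using out pair_graph_arc_in_verts[OF assms(2)] by blast
  qed
  show thesis
  proof (rule that[OF P, where c = c])
    show "c A B = c B A" for A B
      by (simp add: c_def disj_commute)
    show "(u, v) \<in> parcs H \<longleftrightarrow> u \<noteq> v \<and> ((u, v) \<in> parcs G) \<noteq> c A B"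
      if "A \<in> P" "B \<in> P" "u \<in> A" "v \<in> B" for A B u v
      using n_eq[OF that] by (cases "c A B") (simp_all add: H_eq)
  qed (use inV in \<open>auto simp: H_eq\<close>)
qed

section \<open>Existence of a winning width\<close>

lemma k_flip_edgeless:
  assumes "pair_graph G"
  shows "k_flip (card (pverts G)) G (G\<lparr>parcs := {}\<rparr>)"
proof -
  let ?P = "(\<lambda>v. {v}) ` pverts G"
  obtain f :: "'a \<Rightarrow> nat" where f: "inj_on f (pverts G)"
    using finite_imp_inj_to_nat_seg[OF pair_graph_finite_verts[OF assms]] by blast
  \<comment> \<open>Only one orientation per edge: the pairs \<open>(A, B)\<close> and \<open>(B, A)\<close> would cancel.\<close>
  define S where "S = {({u}, {v}) | u v. (u, v) \<in> parcs G \<and> f u < f v}"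
  have S: "S \<subseteq> ?P \<times> ?P"
    using pair_graph_arc_in_verts[OF assms] by (auto simp: S_def)
  then have "finite S"
    using pair_graph_finite_verts[OF assms] by (meson finite_SigmaI finite_imageI finite_subset)
  have "((u, v) \<in> parcs G) = odd (card {s \<in> S. (u, v) \<in> fst s \<times> snd s \<union> snd s \<times> fst s})"
    (is "_ = odd (card ?T)") if "u \<noteq> v" for u v
  proof (cases "(u, v) \<in> parcs G")
    case True
    then have "f u \<noteq> f v"
      using f that pair_graph_arc_in_verts[OF assms] by (auto dest: inj_onD)
    then have "?T = {if f u < f v then ({u}, {v}) else ({v}, {u})}"
      using True pair_graph_sym[OF assms] by (auto simp: S_def)
    then show ?thesis
      using True by simp
  next
    case False
    then have "?T = {}"
      using pair_graph_sym[OF assms] by (auto simp: S_def)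
    then show ?thesis
      using False by (metis card.empty even_zero)
  qed
  then have "flips S G = G\<lparr>parcs := {}\<rparr>"
    unfolding flips_eq[OF \<open>finite S\<close> pair_graph_no_loop[OF assms]]
    by (intro pair_pre_digraph.equality) auto
  moreover have "partition_on (pverts G) ?P"
    by (auto simp: partition_on_def disjoint_def)
  moreover have "card ?P \<le> card (pverts G)"
    using pair_graph_finite_verts[OF assms] by (rule card_image_le)
  ultimately show ?thesis
    using S pair_graph_finite_verts[OF assms] unfolding k_flip_def partition_flip_def
    by (intro exI[of _ ?P] exI[of _ S] conjI) simp_all
qed

text \<open>Makes the \<open>LEAST\<close> in \<open>flip_width\<close> an attained minimum: once
  the edgeless graph is announced, the first move of the runner already loses.\<close>

lemma exists_winning_strategy:
  assumes "pair_graph G" "pverts G \<noteq> {}"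
  shows "\<exists>k \<ge> 1. \<exists>\<sigma>. flipper_winning_strategy r k G \<sigma>"
proof (intro exI conjI)
  show "card (pverts G) \<ge> 1"
    using assms pair_graph_finite_verts[OF assms(1)] by (simp add: Suc_le_eq card_gt_0_iff)
  show "flipper_winning_strategy r (card (pverts G)) G (\<lambda>_. G\<lparr>parcs := {}\<rparr>)"
    unfolding flipper_winning_strategy_def
  proof (intro conjI allI impI)
    fix v assume "runner_play r G (\<lambda>_. G\<lparr>parcs := {}\<rparr>) v"
    then have "reachable_within r G (v 0) (v 1)"
      by (auto simp: runner_play_def game_graph_def dest: spec[of _ 1])
    then have "v 1 \<in> pverts G"
      unfolding reachable_within_def pre_digraph.apath_def
      using wf_digraph.awalk_last_in_verts[of "with_proj G"] assms(1)
      by (metis pair_graph_def pair_digraph_def pair_fin_digraph_def wf_digraph_wp_iff with_proj_simps(1))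
    then show "\<exists>i. isolated_vertex (game_graph G (\<lambda>_. G\<lparr>parcs := {}\<rparr>) v i) (v i)"
      by (intro exI[of _ 1]) (simp add: game_graph_def isolated_vertex_def)
  qed (rule k_flip_edgeless[OF assms(1)])
qed

section \<open>One round against 2-flips\<close>

text \<open>Paths with at most two arcs fit into every radius \<open>r \<ge> 2\<close>, finite or
  not.\<close>

lemma reachable_within_steps:
  assumes "\<And>x y. (x, y) \<in> parcs H \<Longrightarrow> x \<in> pverts H \<and> y \<in> pverts H" and "r \<ge> 2"
  shows reachable_within_refl: "u \<in> pverts H \<Longrightarrow> reachable_within r H u u"
    and reachable_within_step:
      "(u, v) \<in> parcs H \<Longrightarrow> u \<noteq> v \<Longrightarrow> reachable_within r H u v"
    and reachable_within_two_steps: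
      "(u, v) \<in> parcs H \<Longrightarrow> (v, w) \<in> parcs H \<Longrightarrow> distinct [u, v, w] \<Longrightarrow> reachable_within r H u w"
proof -
  have apath: "pre_digraph.apath (with_proj H) u p v \<longleftrightarrow>
      u \<in> pverts H \<and> set p \<subseteq> parcs H \<and> pcas u p v \<and> distinct (pawalk_verts u p)" for u p v
    by (auto simp: pre_digraph.apath_def pre_digraph.awalk_def cas_with_proj_eq
        awalk_verts_with_proj_eq)
  have r: "enat n \<le> r" if "n \<le> 2" for n
    using that assms(2) by (metis enat_ord_simps(1) numeral_eq_enat order_trans)
  show "u \<in> pverts H \<Longrightarrow> reachable_within r H u u"
    unfolding reachable_within_def apath by (rule exI[of _ "[]"]) (simp add: r)
  show "(u, v) \<in> parcs H \<Longrightarrow> u \<noteq> v \<Longrightarrow> reachable_within r H u v"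
    unfolding reachable_within_def apath using assms(1)
    by (intro exI[of _ "[(u, v)]"]) (auto simp: r)
  show "(u, v) \<in> parcs H \<Longrightarrow> (v, w) \<in> parcs H \<Longrightarrow> distinct [u, v, w] \<Longrightarrow> reachable_within r H u w"
    unfolding reachable_within_def apath using assms(1)
    by (intro exI[of _ "[(u, v), (v, w)]"]) (auto simp: r)
qed

text \<open>\<open>H\<close> is the graph in which the runner moves and \<open>K\<close> the one
  announced just before the move, so standing on a non-isolated vertex is an invariant of the
  rounds.\<close>

lemma runner_survives_round:
  assumes G: "pair_graph G" "all_pairs_mixed G" and r: "r \<ge> 2"
    and H: "k_flip 2 G H" and K: "k_flip 2 G K"
    and v: "v \<in> pverts G" "\<not> isolated_vertex H v"
  shows "\<exists>x \<in> pverts G. reachable_within r H v x \<and> \<not> isolated_vertex K x"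
proof (rule ccontr)
  assume trapped: "\<not> ?thesis"
  obtain P c where P: "partition_on (pverts G) P" "finite P" "card P \<le> 2" "pverts H = pverts G"
    and c: "\<And>A B. c A B = c B A"
    and arc: "\<And>A B u v. A \<in> P \<Longrightarrow> B \<in> P \<Longrightarrow> u \<in> A \<Longrightarrow> v \<in> B \<Longrightarrow>
       (u, v) \<in> parcs H \<longleftrightarrow> u \<noteq> v \<and> ((u, v) \<in> parcs G) \<noteq> c A B"
    and H_in: "\<And>u v. (u, v) \<in> parcs H \<Longrightarrow> u \<in> pverts G \<and> v \<in> pverts G"
    by (rule k_flip_cases[OF H G(1)]) (rule that)
  obtain P' c' where P': "partition_on (pverts G) P'" "finite P'" "card P' \<le> 2"
      "pverts K = pverts G"
    and c': "\<And>A B. c' A B = c' B A"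
    and arc': "\<And>A B u v. A \<in> P' \<Longrightarrow> B \<in> P' \<Longrightarrow> u \<in> A \<Longrightarrow> v \<in> B \<Longrightarrow>
       (u, v) \<in> parcs K \<longleftrightarrow> u \<noteq> v \<and> ((u, v) \<in> parcs G) \<noteq> c' A B"
    and "\<And>u v. (u, v) \<in> parcs K \<Longrightarrow> u \<in> pverts G \<and> v \<in> pverts G"
    by (rule k_flip_cases[OF K G(1)]) (rule that)
  have pigeonhole: "A = B \<or> A = C \<or> B = C"
    if "finite Q" "card Q \<le> 2" "A \<in> Q" "B \<in> Q" "C \<in> Q" for Q and A B C :: "'a set"
    using that card_mono[of Q "{A, B, C}"] by (auto simp: card_insert_if split: if_splits)
  have cell: "\<exists>A \<in> P. x \<in> A" and cell': "\<exists>A \<in> P'. x \<in> A" if "x \<in> pverts G" for x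
    using P(1) P'(1) that by (auto simp: partition_on_def)
  have isolated: "(x, y) \<notin> parcs K" if "x \<in> pverts G" "reachable_within r H v x" for x y
    using trapped that by (auto simp: isolated_vertex_def)
  note reach = reachable_within_steps[of H, OF _ r, unfolded P(4), OF H_in]
  obtain u where vu: "(v, u) \<in> parcs H"
    using v P(4) by (auto simp: isolated_vertex_def)
  obtain A where A: "A \<in> P" "v \<in> A"
    using cell v(1) by blast
  obtain A' where A': "A' \<in> P'" "v \<in> A'"
    using cell' v(1) by blast
  have u: "u \<in> pverts G"
    using H_in vu by blast
  obtain B where B: "B \<in> P" "u \<in> B"
    using cell u by blast
  obtain B' where B': "B' \<in> P'" "u \<in> B'"
    using cell' u by blast
  have "v \<noteq> u"
    using arc[OF A(1) B(1) A(2) B(2)] vu by simp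
  have no_twins: False
    if xy: "x \<in> pverts G" "y \<in> pverts G" "x \<noteq> y"
      and "\<And>w. w \<in> pverts G \<Longrightarrow> w \<notin> {x, y} \<Longrightarrow> ((x, w) \<in> parcs G) = ((y, w) \<in> parcs G)" for x y
    using G(2) that unfolding all_pairs_mixed_def by blast
  \<comment> \<open>For isolated vertices of \<open>K\<close> in one part \<open>C\<close>,
    adjacency in \<open>G\<close> to a third vertex is dictated by \<open>c'\<close>, hence the same
    for both, against the first half of mixedness.\<close>
  have one_per_cell: False
    if "x \<in> pverts G" "y \<in> pverts G" "x \<noteq> y" "C \<in> P'" "x \<in> C" "y \<in> C"
      "reachable_within r H v x" "reachable_within r H v y" for x y C
  proof (rule no_twins[OF that(1-3)])
    fix w assume "w \<in> pverts G" "w \<notin> {x, y}"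
    moreover obtain D where "D \<in> P'" "w \<in> D"
      using cell' \<open>w \<in> pverts G\<close> by blast
    ultimately show "((x, w) \<in> parcs G) = ((y, w) \<in> parcs G)"
      using arc'[of C D x w] arc'[of C D y w] that isolated by auto
  qed
  have v_reach: "reachable_within r H v v" and u_reach: "reachable_within r H v u"
    using reach(1,2) v(1) vu \<open>v \<noteq> u\<close> by blast+
  have "A' \<noteq> B'"
    using one_per_cell[OF v(1) u \<open>v \<noteq> u\<close> A'] B' v_reach u_reach by blast
  \<comment> \<open>Otherwise \<open>v\<close>, \<open>u\<close>, \<open>w\<close> would be three
    reachable, hence isolated, vertices of \<open>K\<close> with at most two parts to hold
    them.\<close>
  have far: "(v, w) \<notin> parcs H \<and> (u, w) \<notin> parcs H" if w: "w \<in> pverts G" "w \<noteq> v" "w \<noteq> u" for w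
  proof (rule ccontr)
    assume "\<not> ?thesis"
    then have w_reach: "reachable_within r H v w"
      using reach(2)[of v w] reach(3)[of v u w] vu w \<open>v \<noteq> u\<close> by auto
    obtain C where C: "C \<in> P'" "w \<in> C"
      using cell' w(1) by blast
    have "C = A' \<or> C = B'"
      using pigeonhole[OF P'(2,3) A'(1) B'(1) C(1)] \<open>A' \<noteq> B'\<close> by blast
    then show False
      using one_per_cell[OF v(1) w(1) _ A' _ v_reach w_reach]
        one_per_cell[OF u w(1) _ B' _ u_reach w_reach] C w by blast
  qed
  \<comment> \<open>By \<open>far\<close>, neither \<open>v\<close> nor \<open>u\<close> has a third
    vertex as neighbour in \<open>H\<close>, so in a common part they would be twins in
    \<open>G\<close>.\<close>
  have "A \<noteq> B"
  proof
    assume "A = B"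
    show False
    proof (rule no_twins[OF v(1) u \<open>v \<noteq> u\<close>])
      fix w assume "w \<in> pverts G" "w \<notin> {v, u}"
      moreover obtain D where "D \<in> P" "w \<in> D"
        using cell \<open>w \<in> pverts G\<close> by blast
      ultimately show "((v, w) \<in> parcs G) = ((u, w) \<in> parcs G)"
        using arc[of A D v w] arc[of B D u w] A B \<open>A = B\<close> far[of w] by auto
    qed
  qed
  \<comment> \<open>The second half of mixedness supplies a vertex at which both flips can be
    compared.\<close>
  obtain w where w: "w \<in> pverts G" "w \<noteq> u" "w \<noteq> v"
    and same: "((v, w) \<in> parcs G) = ((u, w) \<in> parcs G)"
    using G(2) v(1) u \<open>v \<noteq> u\<close> unfolding all_pairs_mixed_def by blast
  obtain C where C: "C \<in> P" "w \<in> C"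
    using cell w(1) by blast
  obtain C' where C': "C' \<in> P'" "w \<in> C'"
    using cell' w(1) by blast
  \<comment> \<open>Whichever part holds \<open>w\<close>, one of \<open>u\<close> and
    \<open>v\<close> lies in the other part, and its non-adjacency to \<open>w\<close> in
    \<open>H\<close> reveals \<open>c A B\<close>; by \<open>same\<close> it does not matter which
    one.\<close>
  have "C = A \<or> C = B"
    using pigeonhole[OF P(2,3) A(1) B(1) C(1)] \<open>A \<noteq> B\<close> by blast
  then have "((v, w) \<in> parcs G) = c A B"
  proof
    assume "C = A"
    then show ?thesis
      using arc[OF B(1) C(1) B(2) C(2)] far[of w] w same c[of A B] by auto
  next
    assume "C = B"
    then show ?thesis
      using arc[OF A(1) C(1) A(2) C(2)] far[of w] w by auto
  qed
  moreover have "C' = A' \<or> C' = B'"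
    using pigeonhole[OF P'(2,3) A'(1) B'(1) C'(1)] \<open>A' \<noteq> B'\<close> by blast
  then have "((v, w) \<in> parcs G) = c' A' B'"
  proof
    assume "C' = A'"
    then show ?thesis
      using arc'[OF B'(1) C'(1) B'(2) C'(2)] isolated[OF u u_reach] w same c'[of A' B'] by auto
  next
    assume "C' = B'"
    then show ?thesis
      using arc'[OF A'(1) C'(1) A'(2) C'(2)] isolated[OF v(1) v_reach] w by auto
  qed
  \<comment> \<open>The edge from \<open>v\<close> to \<open>u\<close> is present in
    \<open>H\<close> and absent in \<open>K\<close>, so \<open>c A B\<close> and
    \<open>c' A' B'\<close> differ, although both were read off from \<open>w\<close>.\<close>
  moreover have "((v, u) \<in> parcs G) \<noteq> c A B"
    using arc[OF A(1) B(1) A(2) B(2)] vu by simp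
  moreover have "((v, u) \<in> parcs G) = c' A' B'"
    using arc'[OF A'(1) B'(1) A'(2) B'(2)] isolated[OF v(1) v_reach] \<open>v \<noteq> u\<close> by simp
  ultimately show False
    by blast
qed

section \<open>From one round to an infinite play\<close>

lemma k_flip_mono: "k_flip k G H \<Longrightarrow> k \<le> l \<Longrightarrow> k_flip l G H"
  unfolding k_flip_def by (meson order_trans)

text \<open>Lets the initial graph be treated like an announced one, so the first move needs no
  separate argument.\<close>

lemma k_flip_refl:
  assumes "pverts G \<noteq> {}" "k \<ge> 1"
  shows "k_flip k G G"
proof -
  have "partition_flip {pverts G} G G"
    by (auto simp: partition_flip_def flips_def intro!: exI[of _ "{}"])
  moreover have "partition_on (pverts G) {pverts G}"
    using assms(1) by (auto simp: partition_on_def)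
  ultimately show ?thesis
    using assms(2) unfolding k_flip_def by (intro exI[of _ "{pverts G}"]) auto
qed

lemma runner_escapes:
  assumes G: "pair_graph G" "all_pairs_mixed G" "parcs G \<noteq> {}" and r: "r \<ge> 2"
    and \<sigma>: "\<And>vs. k_flip 2 G (\<sigma> vs)"
  obtains v where "runner_play r G \<sigma> v"
    "\<And>i. \<not> isolated_vertex (game_graph G \<sigma> v i) (v i)"
proof -
  obtain a b where ab: "(a, b) \<in> parcs G"
    using G(3) by auto
  then have a: "a \<in> pverts G"
    using pair_graph_arc_in_verts[OF G(1)] by blast
  \<comment> \<open>\<open>g\<close> sends the first \<open>i\<close> positions to the graph of
    round \<open>i\<close>; the empty history gives round 0.\<close>
  define g where "g hs = (if hs = [] then G else \<sigma> hs)" for hs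
  have g_flip: "k_flip 2 G (g hs)" for hs
    using \<sigma> k_flip_refl[of G 2] a by (auto simp: g_def)
  \<comment> \<open>Since the announced graphs depend on the whole past, the choice is made on histories: the
    positions up to round \<open>n\<close> form a list of length \<open>n + 1\<close>.\<close>
  have "\<exists>h. \<forall>n. (h n \<noteq> [] \<and> length (h n) = Suc n \<and> last (h n) \<in> pverts G \<and>
        \<not> isolated_vertex (g (butlast (h n))) (last (h n))) \<and>
      (\<exists>x. h (Suc n) = h n @ [x] \<and> reachable_within r (g (butlast (h n))) (last (h n)) x)"
  proof (rule dependent_nat_choice)
    show "\<exists>hs. hs \<noteq> [] \<and> length hs = Suc 0 \<and> last hs \<in> pverts G \<and>
        \<not> isolated_vertex (g (butlast hs)) (last hs)"
      using a ab by (intro exI[of _ "[a]"]) (auto simp: g_def isolated_vertex_def)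
  next
    fix hs n
    assume hs: "hs \<noteq> [] \<and> length hs = Suc n \<and> last hs \<in> pverts G \<and>
        \<not> isolated_vertex (g (butlast hs)) (last hs)"
    then obtain x where "x \<in> pverts G" "reachable_within r (g (butlast hs)) (last hs) x"
      "\<not> isolated_vertex (g hs) x"
      using runner_survives_round[OF G(1,2) r g_flip g_flip] by blast
    then show "\<exists>hs'. (hs' \<noteq> [] \<and> length hs' = Suc (Suc n) \<and> last hs' \<in> pverts G \<and>
          \<not> isolated_vertex (g (butlast hs')) (last hs')) \<and>
        (\<exists>x. hs' = hs @ [x] \<and> reachable_within r (g (butlast hs)) (last hs) x)"
      using hs by (intro exI[of _ "hs @ [x]"]) auto
  qed
  then obtain h where len: "\<And>n. length (h n) = Suc n"
    and inV: "\<And>n. last (h n) \<in> pverts G"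
    and alive: "\<And>n. \<not> isolated_vertex (g (butlast (h n))) (last (h n))"
    and step: "\<And>n. \<exists>x. h (Suc n) = h n @ [x] \<and>
      reachable_within r (g (butlast (h n))) (last (h n)) x"
    by metis
  \<comment> \<open>Each history extends the previous one, so their last entries form a single play
    of which all histories are prefixes.\<close>
  have hist: "h n = map (\<lambda>i. last (h i)) [0..<Suc n]" for n
  proof (induction n)
    case 0
    then show ?case
      using len[of 0] by (cases "h 0") auto
  next
    case (Suc n)
    then show ?case
      using step[of n] by auto
  qed
  \<comment> \<open>\<open>butlast\<close> drops the position of round \<open>n\<close> and leaves
    the \<open>n\<close> earlier ones, which is what the flipper sees in round
    \<open>n\<close>.\<close>
  have graph: "game_graph G \<sigma> (\<lambda>i. last (h i)) n = g (butlast (h n))" for n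
    by (subst hist) (simp add: game_graph_def g_def)
  show thesis
  proof (rule that)
    show "runner_play r G \<sigma> (\<lambda>i. last (h i))"
      unfolding runner_play_def graph
    proof (intro conjI allI impI)
      fix i :: nat assume "1 \<le> i"
      then show "reachable_within r (g (butlast (h (i - 1)))) (last (h (i - 1))) (last (h i))"
        using step[of "i - 1"] by auto
    qed (rule inV)
    show "\<not> isolated_vertex (game_graph G \<sigma> (\<lambda>i. last (h i)) i) (last (h i))" for i
      unfolding graph by (rule alive)
  qed
qed

lemma flip_width_ge_3:
  assumes G: "pair_graph G" "all_pairs_mixed G" "parcs G \<noteq> {}" and r: "r \<ge> 2"
  shows "flip_width r G \<ge> 3"
proof (rule ccontr)
  assume less: "\<not> ?thesis"
  have "pverts G \<noteq> {}"
    using G(3) pair_graph_arc_in_verts[OF G(1)] by auto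
  then obtain \<sigma> where \<sigma>: "flipper_winning_strategy r (flip_width r G) G \<sigma>"
    unfolding flip_width_def
    using LeastI_ex[OF exists_winning_strategy[OF G(1), of r, unfolded Bex_def]] by blast
  then have "k_flip 2 G (\<sigma> vs)" for vs
    using less k_flip_mono[of _ G "\<sigma> vs" 2] unfolding flipper_winning_strategy_def by force
  then obtain v where "runner_play r G \<sigma> v"
    "\<And>i. \<not> isolated_vertex (game_graph G \<sigma> v i) (v i)"
    using runner_escapes[OF G r] by blast
  then show False
    using \<sigma> unfolding flipper_winning_strategy_def by blast
qed

section \<open>Transfer to isomorphic copies of the four graphs\<close>

text \<open>An isomorphism carries separate maps for vertices and arcs; since tail and head are
  \<open>fst\<close> and \<open>snd\<close> on both sides, the arc map must apply the vertex map to
  both ends.\<close>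

lemma digraph_iso_with_projE:
  assumes "digraph_iso (with_proj G) (with_proj K)"
  obtains f where "bij_betw f (pverts G) (pverts K)"
    "\<And>u v. u \<in> pverts G \<Longrightarrow> v \<in> pverts G \<Longrightarrow> (u, v) \<in> parcs G \<longleftrightarrow> (f u, f v) \<in> parcs K"
proof -
  obtain h where h: "pre_digraph.digraph_isomorphism (with_proj G) h"
    and K: "with_proj K = app_iso h (with_proj G)"
    using assms by (auto simp: digraph_iso_def)
  let ?f = "iso_verts h"
  have wf: "pair_wf_digraph G"
    using h unfolding pre_digraph.digraph_isomorphism_def wf_digraph_wp_iff by blast
  have inj: "inj_on ?f (pverts G)"
    using h by (simp add: pre_digraph.digraph_isomorphism_def)
  have verts: "pverts K = ?f ` pverts G" and arcs: "parcs K = iso_arcs h ` parcs G"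
    and tail: "iso_tail h = fst" and head: "iso_head h = snd"
    using arg_cong[OF K, of verts] arg_cong[OF K, of arcs] arg_cong[OF K, of tail]
      arg_cong[OF K, of head] by simp_all
  have arc_image: "iso_arcs h (u, v) = (?f u, ?f v)" if "(u, v) \<in> parcs G" for u v
    using h that by (auto simp: pre_digraph.digraph_isomorphism_def tail head prod_eq_iff)
  show thesis
  proof (rule that)
    show "bij_betw ?f (pverts G) (pverts K)"
      using inj verts by (simp add: bij_betw_def)
    show "(u, v) \<in> parcs G \<longleftrightarrow> (?f u, ?f v) \<in> parcs K"
      if uv: "u \<in> pverts G" "v \<in> pverts G" for u v
    proof
      assume "(?f u, ?f v) \<in> parcs K"
      then obtain e where "e \<in> parcs G" "(?f u, ?f v) = iso_arcs h e"
        unfolding arcs by blast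
      then obtain x y where xy: "(x, y) \<in> parcs G" "(?f u, ?f v) = (?f x, ?f y)"
        using arc_image by (cases e) auto
      then have "x \<in> pverts G" "y \<in> pverts G"
        using pair_wf_digraph.arc_fst_in_verts[OF wf] pair_wf_digraph.arc_snd_in_verts[OF wf]
        by fastforce+
      then show "(u, v) \<in> parcs G"
        using xy uv inj by (auto dest: inj_onD)
    qed (metis arc_image arcs imageI)
  qed
qed

lemma all_pairs_mixed_iso:
  assumes "digraph_iso (with_proj G) (with_proj K)" "all_pairs_mixed K"
  shows "all_pairs_mixed G"
proof -
  obtain f where f: "bij_betw f (pverts G) (pverts K)"
    and arc: "\<And>u v. u \<in> pverts G \<Longrightarrow> v \<in> pverts G \<Longrightarrow>
      (u, v) \<in> parcs G \<longleftrightarrow> (f u, f v) \<in> parcs K"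
    using digraph_iso_with_projE[OF assms(1)] by blast
  have inj: "inj_on f (pverts G)" and K: "pverts K = f ` pverts G"
    using f by (auto simp: bij_betw_def)
  have "(\<exists>w \<in> pverts G - {u, v}. ((u, w) \<in> parcs G) \<noteq> ((v, w) \<in> parcs G)) \<and>
     (\<exists>w \<in> pverts G - {u, v}. ((u, w) \<in> parcs G) = ((v, w) \<in> parcs G))"
    if uv: "u \<in> pverts G" "v \<in> pverts G" "u \<noteq> v" for u v
  proof -
    have "f u \<noteq> f v"
      using inj uv by (auto dest: inj_onD)
    then have "(\<exists>w \<in> pverts K - {f u, f v}. ((f u, w) \<in> parcs K) \<noteq> ((f v, w) \<in> parcs K)) \<and>
       (\<exists>w \<in> pverts K - {f u, f v}. ((f u, w) \<in> parcs K) = ((f v, w) \<in> parcs K))"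
      using assms(2) uv unfolding all_pairs_mixed_def K by blast
    then obtain w w' where "w \<in> pverts G - {u, v}" "((f u, f w) \<in> parcs K) \<noteq> ((f v, f w) \<in> parcs K)"
      "w' \<in> pverts G - {u, v}" "((f u, f w') \<in> parcs K) = ((f v, f w') \<in> parcs K)"
      unfolding K by blast
    then show ?thesis
      using arc uv by blast
  qed
  then show ?thesis
    by (simp add: all_pairs_mixed_def)
qed

lemma parcs_nonempty_iso:
  assumes "digraph_iso (with_proj G) (with_proj K)" "parcs K \<noteq> {}"
  shows "parcs G \<noteq> {}"
proof -
  obtain h where "with_proj K = app_iso h (with_proj G)"
    using assms(1) by (auto simp: digraph_iso_def)
  then have "parcs K = iso_arcs h ` parcs G"
    by (metis arcs_app_iso with_proj_simps(2))
  then show ?thesis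
    using assms(2) by auto
qed

text \<open>All quantifiers range over explicit finite sets, so evaluation decides the
  claims.\<close>

lemma all_pairs_mixed_five_vertices:
  "all_pairs_mixed C5_graph" "all_pairs_mixed bull_graph"
  "all_pairs_mixed gem_graph" "all_pairs_mixed co_gem_graph"
  by code_simp+

theorem theorem3p6:
  fixes G :: "'a pair_pre_digraph" and r :: enat
  assumes "pair_graph G"
    and "digraph_iso (with_proj G) (with_proj C5_graph) \<or>
         digraph_iso (with_proj G) (with_proj bull_graph) \<or>
         digraph_iso (with_proj G) (with_proj gem_graph) \<or>
         digraph_iso (with_proj G) (with_proj co_gem_graph)"
    and "r \<ge> 2"
  shows "flip_width r G \<ge> 3"
proof -
  obtain K :: "nat pair_pre_digraph" where K: "digraph_iso (with_proj G) (with_proj K)"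
    "K \<in> {C5_graph, bull_graph, gem_graph, co_gem_graph}"
    using assms(2) by blast
  then have "all_pairs_mixed K" "parcs K \<noteq> {}"
    using all_pairs_mixed_five_vertices
    by (auto simp: C5_graph_def bull_graph_def gem_graph_def co_gem_graph_def graph_of_def)
  then show ?thesis
    using flip_width_ge_3[OF assms(1) all_pairs_mixed_iso[OF K(1)] parcs_nonempty_iso[OF K(1)]]
      assms(3) by blast
qed

end
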